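(* Let $\mathcal F$ be a function ring over a field $K$ and let $F$ be a set of polynomials in $\mathcal F\setminus\{o\}$. Then $F$ is a weak right reductive Gröbner basis of $\mathrm{ideal}_r(F)$ if and only if (1) for all $f\in F$ and all monomials $m\in M(\mathcal F)$ the multiple $f\star m$ has a right reductive standard representation in terms of $F$, and (2) for all $p,q\in F$ (not necessarily different) and every tuple $(t,u_1,u_2)\in\mathcal C_s(p,q)$ the s-polynomial $\mathrm{spol}_r(p,q,t,u_1,u_2)$ has a right reductive standard representation in terms of $F$.
   Context: Function ring: $T$ is a set, $K$ a field, and $\mathcal F$ is the set of functions $f:T\to K$ with finite support $\mathrm{supp}(f)$; $\mathcal F$ has pointwise addition, zero function $o$, scalar multiplication $(\alpha\cdot f)(t)=(f\cdot\alpha)(t)=\alpha f(t)$, and a multiplication $\star:\mathcal F\times\mathcal F\to\mathcal F$ making it an associative ring (not necessarily with unit) such that $(\alpha\cdot f)\star g=\alpha\cdot(f\star g)$ and $f\star(g\cdot\alpha)=(f\star g)\cdot\alpha$. Elements of $\mathcal F$ are called polynomials. $M(\mathcal F)$ is the set of monomials (functions with one-element support); monomials with coefficient $1$ are identified with elements of $T$ (terms). $\mathrm{ideal}_r(F)=\{\sum_{i=1}^n f_i\star g_i\mid f_i\in F,\ g_i\in\mathcal F,\ n\in\mathbb N\}$. $\succeq$ is a fixed total well-founded ordering on $T$. For $f\ne o$, $\operatorname{HT}(f)$ is the $\succeq$-largest element of $\mathrm{supp}(f)$ and $\operatorname{HC}(f)=f(\operatorname{HT}(f))$; for a set, $\operatorname{HT}(S)=\{\operatorname{HT}(f)\mid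 f\in S\}$. For $t\in T$, $g\in\mathcal F$, "$t\succ g$" means $g=o$ or $t\succ\operatorname{HT}(g)$. An inequality $\operatorname{HT}(g)\succ\operatorname{HT}(h)$ is regarded as satisfied if $h=o$; an equality $\operatorname{HT}(h)=t$ presupposes $h\ne o$. $\geq$ is a fixed right reductive restriction of $\succeq$: a partial ordering on $T$ such that $t\ge s$ implies $t\succeq s$, and such that for $t,t_1,t_2,w\in T$: if $t_2\ge t_1$, $t_1\succ t$ and $t_2=\operatorname{HT}(t_1\star w)$, then $t_2\succ t\star w$. A right reductive standard representation of $g\neq o$ in terms of $F$ is a representation $g=\sum_{i=1}^n f_i\star m_i$, $f_i\in F$, $m_i\in M(\mathcal F)$, such that for some $k\ge1$: $\operatorname{HT}(g)=\operatorname{HT}(f_i\star m_i)=\operatorname{HT}(\operatorname{HT}(f_i)\star m_i)\ge\operatorname{HT}(f_i)$ for $1\le i\le k$ and $\operatorname{HT}(g)\succ\operatorname{HT}(f_i\star m_i)$ for $k<i\le n$. The empty sum is the right reductive standard representation of $o$. $F\subseteq\mathcal F\setminus\{o\}$ is a weak right reductive Gröbner basis of $\mathrm{ideal}_r(F)$ if $\operatorname{HT}(\mathrm{ideal}_r(F)\setminus\{o\})=\operatorname{HT}(\{f\star m\mid f\in F,\ m\in M(\mathcal F),\ \operatorname{HT}(f\star m)=\operatorname{HT}(\operatorname{HT}(f)\star m)\ge\operatorname{HT}(f)\}\setminus\{o\})$. For non-zero $p,q$: $\mathcal C_s(p,q)$ is the set of $(t,u_1,u_2)\in T^3$ with $\operatorname{HT}(p\star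 u_1)=\operatorname{HT}(\operatorname{HT}(p)\star u_1)=t=\operatorname{HT}(q\star u_2)=\operatorname{HT}(\operatorname{HT}(q)\star u_2)$, $\operatorname{HT}(p)\le t$ and $\operatorname{HT}(q)\le t$; and $\mathrm{spol}_r(p,q,t,u_1,u_2)=\operatorname{HC}(p\star u_1)^{-1}\cdot p\star u_1-\operatorname{HC}(q\star u_2)^{-1}\cdot q\star u_2$. *)

theory Defs
  imports "HOL-Library.Poly_Mapping"
begin

(* Finitely supported functions T -> K are the type of Poly_Mapping, with keys as support.
   The total well-founded ordering on T is the order of the class wellorder. *)

definition scale :: "'k::field \<Rightarrow> ('t \<Rightarrow>\<^sub>0 'k) \<Rightarrow> ('t \<Rightarrow>\<^sub>0 'k)" where
  "scale \<alpha> f = Poly_Mapping.map (\<lambda>c. \<alpha> * c) f"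

definition monomials :: "('t \<Rightarrow>\<^sub>0 'k::field) set" where
  "monomials = {m. card (Poly_Mapping.keys m) = 1}"

definition mon_of_term :: "'t \<Rightarrow> ('t \<Rightarrow>\<^sub>0 'k::field)" where
  "mon_of_term t = Poly_Mapping.single t 1"

(* HT and HC are meaningful only for non-zero arguments. *)
definition HT :: "('t::wellorder \<Rightarrow>\<^sub>0 'k::field) \<Rightarrow> 't" where
  "HT f = Max (Poly_Mapping.keys f)"

definition HC :: "('t::wellorder \<Rightarrow>\<^sub>0 'k::field) \<Rightarrow> 'k" where
  "HC f = Poly_Mapping.lookup f (HT f)"

(* An equation HT h = t presupposes that h is non-zero, whereas HT h < t counts as satisfied
   when h is zero. *)
definition HT_eq :: "('t::wellorder \<Rightarrow>\<^sub>0 'k::field) \<Rightarrow> 't \<Rightarrow> bool" where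
  "HT_eq h t \<longleftrightarrow> h \<noteq> 0 \<and> HT h = t"

definition HT_less :: "('t::wellorder \<Rightarrow>\<^sub>0 'k::field) \<Rightarrow> 't \<Rightarrow> bool" where
  "HT_less h t \<longleftrightarrow> h = 0 \<or> HT h < t"

(* The additive group structure is the one of Poly_Mapping; the multiplication is a parameter,
   unrelated to the convolution product of Poly_Mapping. *)
locale function_ring =
  fixes star :: "('t \<Rightarrow>\<^sub>0 'k::field) \<Rightarrow> ('t \<Rightarrow>\<^sub>0 'k) \<Rightarrow> ('t \<Rightarrow>\<^sub>0 'k)"  (infixl "\<star>" 70)
  assumes star_assoc: "(f \<star> g) \<star> h = f \<star> (g \<star> h)"
    and star_distrib_right: "(f + g) \<star> h = f \<star> h + g \<star> h"
    and star_distrib_left: "f \<star> (g + h) = f \<star> g + f \<star> h"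
    and scale_star: "scale \<alpha> f \<star> g = scale \<alpha> (f \<star> g)"
    and star_scale: "f \<star> scale \<alpha> g = scale \<alpha> (f \<star> g)"

(* Here ge t s stands for the partial ordering "t >= s" refining the well-ordering of T. *)
locale right_reductive_restriction =
  fixes star :: "('t::wellorder \<Rightarrow>\<^sub>0 'k::field) \<Rightarrow> ('t \<Rightarrow>\<^sub>0 'k) \<Rightarrow> ('t \<Rightarrow>\<^sub>0 'k)"  (infixl "\<star>" 70)
    and ge :: "'t \<Rightarrow> 't \<Rightarrow> bool"
  assumes ge_refl: "reflp ge"
    and ge_antisym: "antisymp ge"
    and ge_trans: "transp ge"
    and ge_imp: "ge t s \<Longrightarrow> s \<le> t"
    and ge_reductive:
      "ge t2 t1 \<Longrightarrow> t < t1 \<Longrightarrow> HT_eq (mon_of_term t1 \<star> mon_of_term w) t2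
        \<Longrightarrow> HT_less (mon_of_term t \<star> mon_of_term w) t2"

context
  fixes star :: "('t::wellorder \<Rightarrow>\<^sub>0 'k::field) \<Rightarrow> ('t \<Rightarrow>\<^sub>0 'k) \<Rightarrow> ('t \<Rightarrow>\<^sub>0 'k)"  (infixl "\<star>" 70)
    and ge :: "'t \<Rightarrow> 't \<Rightarrow> bool"
begin

definition ideal_r :: "('t \<Rightarrow>\<^sub>0 'k) set \<Rightarrow> ('t \<Rightarrow>\<^sub>0 'k) set" where
  "ideal_r F = {\<Sum>i=1..n. f i \<star> g i | (n::nat) f g. \<forall>i\<in>{1..n}. f i \<in> F}"

(* HT (f * m) = HT (HT f * m) = t >= HT f *)
definition HT_reductive :: "('t \<Rightarrow>\<^sub>0 'k) \<Rightarrow> ('t \<Rightarrow>\<^sub>0 'k) \<Rightarrow> 't \<Rightarrow> bool" where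
  "HT_reductive f m t \<longleftrightarrow>
     HT_eq (f \<star> m) t \<and> HT_eq (mon_of_term (HT f) \<star> m) t \<and> ge t (HT f)"

definition has_right_reductive_standard_rep ::
    "('t \<Rightarrow>\<^sub>0 'k) set \<Rightarrow> ('t \<Rightarrow>\<^sub>0 'k) \<Rightarrow> bool" where
  "has_right_reductive_standard_rep F g \<longleftrightarrow>
     g = 0 \<or>
     (\<exists>(n::nat) k f m.
        1 \<le> k \<and> k \<le> n \<and>
        (\<forall>i\<in>{1..n}. f i \<in> F \<and> m i \<in> monomials) \<and>
        g = (\<Sum>i=1..n. f i \<star> m i) \<and>
        (\<forall>i\<in>{1..k}. HT_reductive (f i) (m i) (HT g)) \<and>
        (\<forall>i\<in>{k<..n}. HT_less (f i \<star> m i) (HT g)))"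

definition weak_right_reductive_groebner_basis :: "('t \<Rightarrow>\<^sub>0 'k) set \<Rightarrow> bool" where
  "weak_right_reductive_groebner_basis F \<longleftrightarrow>
     0 \<notin> F \<and>
     HT ` (ideal_r F - {0}) =
     HT ` ({f \<star> m | f m. f \<in> F \<and> m \<in> monomials \<and> HT_reductive f m (HT (f \<star> m))} - {0})"

definition critical_tuples :: "('t \<Rightarrow>\<^sub>0 'k) \<Rightarrow> ('t \<Rightarrow>\<^sub>0 'k) \<Rightarrow> ('t \<times> 't \<times> 't) set" where
  "critical_tuples p q =
     {(t, u1, u2). HT_reductive p (mon_of_term u1) t \<and> HT_reductive q (mon_of_term u2) t}"

definition spol_r :: "('t \<Rightarrow>\<^sub>0 'k) \<Rightarrow> ('t \<Rightarrow>\<^sub>0 'k) \<Rightarrow> 't \<Rightarrow> 't \<Rightarrow> 't \<Rightarrow> ('t \<Rightarrow>\<^sub>0 'k)" where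
  "spol_r p q t u1 u2 =
     scale (inverse (HC (p \<star> mon_of_term u1))) (p \<star> mon_of_term u1)
     - scale (inverse (HC (q \<star> mon_of_term u2))) (q \<star> mon_of_term u2)"

end

end

theory Submission
  imports Defs HOL.Vector_Spaces
begin

text \<open>
  Call \<open>f \<star> m\<close> a reductive multiple if \<open>f \<in> F\<close> and \<open>HT (f \<star> m) = HT (HT f \<star> m) \<ge> HT f\<close>.

  If \<open>F\<close> is a weak Groebner basis, a non-zero element of the ideal has the same head term as some
  reductive multiple; subtracting a scalar multiple of the latter lowers the head term, and
  well-founded induction yields a standard representation.

  Conversely, iterating (1) writes each \<open>f \<star> m\<close>, hence each element of the ideal, as a linear
  combination of reductive multiples. If two reductive multiples have the same head term \<open>t\<close>, then
  by (2) they are, modulo the span of the reductive multiples with head term below \<open>t\<close>, scalar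
  multiples of each other. So in a linear combination with largest occurring head term \<open>t\<close> all
  summands with head term \<open>t\<close> merge into one; either it survives and \<open>t\<close> is the head term of the
  sum, or the sum lies in the span of reductive multiples with smaller head terms.
\<close>

section \<open>Scalars, head terms and monomials\<close>

lemma lookup_scale [simp]: "Poly_Mapping.lookup (scale c f) t = c * Poly_Mapping.lookup f t"
  by (simp add: scale_def Poly_Mapping.map.rep_eq when_def)

text \<open>Provides \<open>poly_vs.span\<close>; the converse direction is linear algebra with
  spans of reductive multiples.\<close>

interpretation poly_vs: vector_space "scale :: 'k::field \<Rightarrow> ('t \<Rightarrow>\<^sub>0 'k) \<Rightarrow> _"
  by unfold_locales (auto intro!: poly_mapping_eqI simp: lookup_add algebra_simps)

lemma HT_in_keys: "f \<noteq> 0 \<Longrightarrow> HT f \<in> Poly_Mapping.keys f"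
  unfolding HT_def by (rule Max_in) auto

lemma HC_nonzero: "f \<noteq> 0 \<Longrightarrow> HC f \<noteq> 0"
  using HT_in_keys[of f] by (simp add: HC_def in_keys_iff)

lemma le_HT: "Poly_Mapping.lookup f t \<noteq> 0 \<Longrightarrow> t \<le> HT f"
  unfolding HT_def by (rule Max_ge) (auto simp: in_keys_iff)

text \<open>Together with \<open>HT_eq_iff\<close> this turns head-term claims into claims about
  coefficients, which are linear and also cover the zero polynomial.\<close>

lemma HT_less_iff: "HT_less f t \<longleftrightarrow> (\<forall>s\<ge>t. Poly_Mapping.lookup f s = 0)"
proof
  assume "HT_less f t"
  then show "\<forall>s\<ge>t. Poly_Mapping.lookup f s = 0"
    by (metis HT_less_def le_HT leD le_less_trans lookup_zero)
next
  assume "\<forall>s\<ge>t. Poly_Mapping.lookup f s = 0"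
  then show "HT_less f t"
    unfolding HT_less_def by (metis HT_in_keys in_keys_iff not_le)
qed

lemma HT_eq_iff:
  "HT_eq f t \<longleftrightarrow> Poly_Mapping.lookup f t \<noteq> 0 \<and> (\<forall>s>t. Poly_Mapping.lookup f s = 0)"
proof
  assume "HT_eq f t"
  then show "Poly_Mapping.lookup f t \<noteq> 0 \<and> (\<forall>s>t. Poly_Mapping.lookup f s = 0)"
    unfolding HT_eq_def by (metis HT_in_keys in_keys_iff le_HT leD)
next
  assume *: "Poly_Mapping.lookup f t \<noteq> 0 \<and> (\<forall>s>t. Poly_Mapping.lookup f s = 0)"
  then have "f \<noteq> 0" by auto
  with * show "HT_eq f t"
    unfolding HT_eq_def by (metis HT_in_keys in_keys_iff le_HT le_neq_trans)
qed

lemma HT_eq_scale [simp]: "c \<noteq> 0 \<Longrightarrow> HT_eq (scale c f) t \<longleftrightarrow> HT_eq f t"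
  by (simp add: HT_eq_iff)

text \<open>After normalization both coefficients at \<open>t\<close> are 1 and cancel. Applied to
  s-polynomials.\<close>

lemma HT_less_cancel:
  assumes "HT_eq p t" and "HT_eq q t"
  shows "HT_less (scale (inverse (HC p)) p - scale (inverse (HC q)) q) t"
proof -
  have "HC p = Poly_Mapping.lookup p t" "HC q = Poly_Mapping.lookup q t"
    using assms by (auto simp: HC_def HT_eq_def)
  then show ?thesis
    using assms by (auto simp: HT_less_iff HT_eq_iff lookup_minus le_less)
qed

lemma HT_less_reduce:
  assumes "g \<noteq> 0" and "HT_eq r (HT g)"
  shows "HT_less (g - scale (HC g / HC r) r) (HT g)"
proof -
  have "HC g = Poly_Mapping.lookup g (HT g)" "HC r = Poly_Mapping.lookup r (HT g)" "HT_eq g (HT g)"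
    using assms by (auto simp: HC_def HT_eq_def)
  then show ?thesis
    using assms by (auto simp: HT_less_iff HT_eq_iff lookup_minus le_less)
qed

text \<open>Polynomials whose coefficients vanish at all terms from \<open>t\<close> upwards form a
  subspace.\<close>

lemma HT_less_span:
  assumes "v \<in> poly_vs.span A" and "\<And>a. a \<in> A \<Longrightarrow> HT_less a t"
  shows "HT_less v t"
  using assms(1)
proof (induction rule: poly_vs.span_induct_alt)
  case base
  show ?case by (simp add: HT_less_iff)
next
  case (step c x y)
  with assms(2)[of x] show ?case by (simp add: HT_less_iff lookup_add)
qed

text \<open>Mediates between standard representations, which use monomials, and s-polynomials, which
  use terms.\<close>

lemma monomial_scale_term:
  assumes "m \<in> monomials"
  obtains c u where "c \<noteq> 0" and "m = scale c (mon_of_term u)"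
proof -
  obtain u where u: "Poly_Mapping.keys m = {u}"
    using assms unfolding monomials_def by (auto simp: card_1_singleton_iff)
  show thesis
  proof
    show "Poly_Mapping.lookup m u \<noteq> 0" using u by (auto simp flip: in_keys_iff)
    show "m = scale (Poly_Mapping.lookup m u) (mon_of_term u)"
      using u by (intro poly_mapping_eqI)
        (auto simp: mon_of_term_def lookup_single when_def simp flip: not_in_keys_iff_lookup_eq_zero)
  qed
qed

lemma mon_of_term_in_monomials: "mon_of_term u \<in> monomials"
  by (simp add: mon_of_term_def monomials_def)

lemma scale_in_monomials: "m \<in> monomials \<Longrightarrow> c \<noteq> 0 \<Longrightarrow> scale c m \<in> monomials"
proof -
  assume "m \<in> monomials" "c \<noteq> 0"
  moreover have "Poly_Mapping.keys (scale c m) = Poly_Mapping.keys m"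
    using \<open>c \<noteq> 0\<close> by (auto simp: in_keys_iff)
  ultimately show ?thesis by (simp add: monomials_def)
qed

lemma in_span_monomials: "g \<in> poly_vs.span (monomials :: ('t \<Rightarrow>\<^sub>0 'k::field) set)"
proof (induction g rule: update_induct)
  case const
  show ?case by (simp add: poly_vs.span_zero)
next
  case (update f k v)
  have "Poly_Mapping.update k v f = f + scale v (mon_of_term k)"
    using update.hyps
    by (intro poly_mapping_eqI)
      (auto simp: lookup_update lookup_add mon_of_term_def lookup_single when_def in_keys_iff)
  with update.IH show ?case
    by (simp add: poly_vs.span_add poly_vs.span_base poly_vs.span_scale mon_of_term_in_monomials)
qed

text \<open>The set on the right-hand side of the weak Groebner condition; 0 need not be removed,
  since \<open>HT_reductive\<close> already forces the product to be non-zero.\<close>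

definition reductive_multiples ::
    "(('t::wellorder \<Rightarrow>\<^sub>0 'k::field) \<Rightarrow> ('t \<Rightarrow>\<^sub>0 'k) \<Rightarrow> ('t \<Rightarrow>\<^sub>0 'k)) \<Rightarrow> ('t \<Rightarrow> 't \<Rightarrow> bool)
      \<Rightarrow> ('t \<Rightarrow>\<^sub>0 'k) set \<Rightarrow> ('t \<Rightarrow>\<^sub>0 'k) set" where
  "reductive_multiples star ge F =
     {star f m | f m. f \<in> F \<and> m \<in> monomials \<and> HT_reductive star ge f m (HT (star f m))}"

lemma zero_notin_reductive_multiples: "0 \<notin> reductive_multiples star ge F"
  by (auto simp: reductive_multiples_def HT_reductive_def HT_eq_def)

lemma HT_reductive_HT: "HT_reductive star ge f m t \<Longrightarrow> HT (star f m) = t"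
  by (simp add: HT_reductive_def HT_eq_def)

lemma weak_groebner_iff:
  "weak_right_reductive_groebner_basis star ge F \<longleftrightarrow>
    0 \<notin> F \<and> HT ` (ideal_r star F - {0}) = HT ` reductive_multiples star ge F"
  unfolding weak_right_reductive_groebner_basis_def
    reductive_multiples_def[symmetric]
  by (simp add: zero_notin_reductive_multiples)

section \<open>Right multiples and the right ideal\<close>

locale ordered_function_ring = function_ring star
  for star :: "('t::wellorder \<Rightarrow>\<^sub>0 'k::field) \<Rightarrow> ('t \<Rightarrow>\<^sub>0 'k) \<Rightarrow> ('t \<Rightarrow>\<^sub>0 'k)"  (infixl "\<star>" 70)
begin

lemma star_zero [simp]: "f \<star> 0 = 0"
  using star_distrib_left[of f 0 0] by simp

lemma star_minus_right: "f \<star> (- g) = - (f \<star> g)"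
  using star_scale[of f "- 1" g] by simp

lemma HT_reductive_scale:
  "c \<noteq> 0 \<Longrightarrow> HT_reductive (\<star>) ge f (scale c m) t \<longleftrightarrow> HT_reductive (\<star>) ge f m t"
  by (simp add: HT_reductive_def star_scale)

text \<open>Multiplication is linear in its right argument and the monomials span all
  polynomials.\<close>

lemma star_in_span:
  assumes "\<And>m. m \<in> monomials \<Longrightarrow> f \<star> m \<in> poly_vs.span A"
  shows "f \<star> g \<in> poly_vs.span A"
  using in_span_monomials[of g]
proof (induction rule: poly_vs.span_induct_alt)
  case base
  show ?case by (simp add: poly_vs.span_zero)
next
  case (step c x y)
  then show ?case
    using assms by (simp add: star_distrib_left star_scale poly_vs.span_add poly_vs.span_scale)
qed

lemma star_in_ideal: "f \<in> F \<Longrightarrow> f \<star> g \<in> ideal_r (\<star>) F"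
  unfolding ideal_r_def
  by (intro CollectI exI[of _ 1] exI[of _ "\<lambda>_. f"] exI[of _ "\<lambda>_. g"]) auto

lemma ideal_add_multiple:
  assumes "h \<in> ideal_r (\<star>) F" and "f \<in> F"
  shows "h + f \<star> g \<in> ideal_r (\<star>) F"
proof -
  obtain n :: nat and f' g' where *: "h = (\<Sum>i=1..n. f' i \<star> g' i)" "\<forall>i\<in>{1..n}. f' i \<in> F"
    using assms(1) unfolding ideal_r_def by auto
  have "h + f \<star> g = (\<Sum>i=1..Suc n. (f'(Suc n := f)) i \<star> (g'(Suc n := g)) i)"
    unfolding *(1) by (simp add: sum.cl_ivl_Suc)
  moreover have "\<forall>i\<in>{1..Suc n}. (f'(Suc n := f)) i \<in> F"
    using *(2) assms(2) by auto
  ultimately show ?thesis unfolding ideal_r_def by blast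
qed

lemma spol_in_ideal:
  assumes "p \<in> F" and "q \<in> F"
  shows "spol_r (\<star>) p q t u1 u2 \<in> ideal_r (\<star>) F"
proof -
  \<comment> \<open>Scalars and the sign move into the right factors, leaving a sum of two right
    multiples.\<close>
  have "spol_r (\<star>) p q t u1 u2 =
      p \<star> scale (inverse (HC (p \<star> mon_of_term u1))) (mon_of_term u1)
      + q \<star> scale (- inverse (HC (q \<star> mon_of_term u2))) (mon_of_term u2)"
    by (simp add: spol_r_def star_scale star_minus_right)
  then show ?thesis
    using assms by (simp only: ideal_add_multiple star_in_ideal)
qed

section \<open>From a weak Groebner basis to standard representations\<close>

lemma standard_rep_add:
  assumes g: "g \<noteq> 0" and f: "f \<in> F" and m: "m \<in> monomials"
    and red: "HT_reductive (\<star>) ge f m (HT g)"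
    and less: "HT_less (g - f \<star> m) (HT g)"
    and rep: "has_right_reductive_standard_rep (\<star>) ge F (g - f \<star> m)"
  shows "has_right_reductive_standard_rep (\<star>) ge F g"
proof (cases "g - f \<star> m = 0")
  case True
  then show ?thesis
    unfolding has_right_reductive_standard_rep_def using f m red
    by (intro disjI2 exI[of _ 1] exI[of _ "\<lambda>_. f"] exI[of _ "\<lambda>_. m"]) auto
next
  case False
  let ?h = "g - f \<star> m"
  obtain n k :: nat and f' m' where k: "1 \<le> k" "k \<le> n"
    and fm: "\<forall>i\<in>{1..n}. f' i \<in> F \<and> m' i \<in> monomials"
    and h: "?h = (\<Sum>i=1..n. f' i \<star> m' i)"
    and eq: "\<forall>i\<in>{1..k}. HT_reductive (\<star>) ge (f' i) (m' i) (HT ?h)"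
    and lt: "\<forall>i\<in>{k<..n}. HT_less (f' i \<star> m' i) (HT ?h)"
    using rep False unfolding has_right_reductive_standard_rep_def by blast
  \<comment> \<open>Every summand of the remainder has head term at most \<open>HT ?h\<close>, hence
    below \<open>HT g\<close>. So \<open>f \<star> m\<close> becomes the only leading summand, and k
    = 1 in the new representation.\<close>
  have "HT ?h < HT g" using less False by (simp add: HT_less_def)
  then have all: "HT_less (f' i \<star> m' i) (HT g)" if "i \<in> {1..n}" for i
    using that eq lt by (cases "i \<le> k") (auto simp: HT_reductive_def HT_eq_def HT_less_def)
  \<comment> \<open>The new summand takes index 1 and the old ones move up by one.\<close>
  define F' where "F' i = (if i = 1 then f else f' (i - 1))" for i
  define M' where "M' i = (if i = 1 then m else m' (i - 1))" for i
  have "(\<Sum>i=1..Suc n. F' i \<star> M' i) = f \<star> m + (\<Sum>i=Suc 1..Suc n. F' i \<star> M' i)"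
    by (subst sum.atLeast_Suc_atMost) (auto simp: F'_def M'_def)
  also have "(\<Sum>i=Suc 1..Suc n. F' i \<star> M' i) = (\<Sum>i=1..n. f' i \<star> m' i)"
    unfolding sum.shift_bounds_cl_Suc_ivl by (rule sum.cong) (auto simp: F'_def M'_def)
  finally have "g = (\<Sum>i=1..Suc n. F' i \<star> M' i)"
    unfolding h[symmetric] by (simp del: sum.cl_ivl_Suc)
  moreover have pred: "i - 1 \<in> {1..n}" if "i \<in> {1<..Suc n}" for i
    using that by simp arith
  then have "\<forall>i\<in>{1..Suc n}. F' i \<in> F \<and> M' i \<in> monomials"
    using fm f m by (simp add: F'_def M'_def)
  moreover have "\<forall>i\<in>{1..1}. HT_reductive (\<star>) ge (F' i) (M' i) (HT g)"
    using red by (simp add: F'_def M'_def)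
  moreover have "\<forall>i\<in>{1<..Suc n}. HT_less (F' i \<star> M' i) (HT g)"
    using all pred by (simp add: F'_def M'_def)
  ultimately show ?thesis
    unfolding has_right_reductive_standard_rep_def
    by (intro disjI2 exI[of _ "Suc n"] exI[of _ 1] exI[of _ F'] exI[of _ M']) simp
qed

lemma standard_rep_if_weak_groebner:
  assumes "weak_right_reductive_groebner_basis (\<star>) ge F"
    and "g \<in> ideal_r (\<star>) F"
  shows "has_right_reductive_standard_rep (\<star>) ge F g"
  using assms(2)
proof (induction "HT g" arbitrary: g rule: less_induct)
  case less
  show ?case
  proof (cases "g = 0")
    case True
    then show ?thesis by (simp add: has_right_reductive_standard_rep_def)
  next
    case False
    have "HT g \<in> HT ` reductive_multiples (\<star>) ge F"
      using False less.prems assms(1) unfolding weak_groebner_iff by blast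
    then obtain f m where f: "f \<in> F" and m: "m \<in> monomials"
      and red: "HT_reductive (\<star>) ge f m (HT g)"
      unfolding reductive_multiples_def by auto
    \<comment> \<open>This factor makes the head coefficients of \<open>g\<close> and
      \<open>f \<star> scale c m\<close> agree; it must be non-zero for \<open>scale c m\<close> to
      remain a monomial.\<close>
    define c where "c = HC g / HC (f \<star> m)"
    have lead: "HT_eq (f \<star> m) (HT g)" using red by (simp add: HT_reductive_def)
    then have c: "c \<noteq> 0"
      using False HC_nonzero[of g] HC_nonzero[of "f \<star> m"] by (simp add: c_def HT_eq_def)
    let ?h = "g - f \<star> scale c m"
    have less_h: "HT_less ?h (HT g)"
      using HT_less_reduce[OF False lead] by (simp add: c_def star_scale)
    have "?h \<in> ideal_r (\<star>) F"
      using ideal_add_multiple[OF less.prems f, of "- scale c m"] by (simp add: star_minus_right)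
    \<comment> \<open>The value of \<open>HT\<close> at 0 is meaningless, so the induction
      hypothesis serves only a non-zero remainder; 0 has the empty representation.\<close>
    then have "has_right_reductive_standard_rep (\<star>) ge F ?h"
      using less.hyps[of ?h] less_h
      by (cases "?h = 0") (auto simp: has_right_reductive_standard_rep_def HT_less_def)
    with False f less_h show ?thesis
      by (intro standard_rep_add[of g f F "scale c m"])
        (auto simp: HT_reductive_scale c red m scale_in_monomials)
  qed
qed

section \<open>From standard representations to spans of reductive multiples\<close>

lemma standard_rep_in_span:
  assumes rep: "has_right_reductive_standard_rep (\<star>) ge F g"
    and lower: "\<And>f m. f \<in> F \<Longrightarrow> m \<in> monomials \<Longrightarrow> f \<star> m \<noteq> 0 \<Longrightarrow> HT (f \<star> m) < HT g \<Longrightarrow>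
      f \<star> m \<in> poly_vs.span {r \<in> reductive_multiples (\<star>) ge F. HT r \<le> HT (f \<star> m)}"
  shows "g \<in> poly_vs.span {r \<in> reductive_multiples (\<star>) ge F. HT r \<le> HT g}"
    (is "_ \<in> poly_vs.span ?R")
proof (cases "g = 0")
  case True
  then show ?thesis by (simp add: poly_vs.span_zero)
next
  case False
  then obtain n k :: nat and f m where k: "1 \<le> k" "k \<le> n"
    and fm: "\<forall>i\<in>{1..n}. f i \<in> F \<and> m i \<in> monomials"
    and g: "g = (\<Sum>i=1..n. f i \<star> m i)"
    and eq: "\<forall>i\<in>{1..k}. HT_reductive (\<star>) ge (f i) (m i) (HT g)"
    and lt: "\<forall>i\<in>{k<..n}. HT_less (f i \<star> m i) (HT g)"
    using rep unfolding has_right_reductive_standard_rep_def by blast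
  \<comment> \<open>The first k summands are themselves generators with head term
    \<open>HT g\<close>. The others are 0 or have smaller head terms, so \<open>lower\<close>
    applies and the span is then enlarged.\<close>
  have "f i \<star> m i \<in> poly_vs.span ?R" if i: "i \<in> {1..n}" for i
  proof (cases "i \<le> k")
    case True
    then have red: "HT_reductive (\<star>) ge (f i) (m i) (HT g)" using i eq by simp
    then have "f i \<star> m i \<in> ?R"
      using fm i HT_reductive_HT[OF red] unfolding reductive_multiples_def
      by (intro CollectI conjI exI[of _ "f i"] exI[of _ "m i"]) auto
    then show ?thesis by (rule poly_vs.span_base)
  next
    case False
    then have *: "HT_less (f i \<star> m i) (HT g)" using i lt by simp
    show ?thesis
    proof (cases "f i \<star> m i = 0")
      case True
      then show ?thesis by (simp add: poly_vs.span_zero)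
    next
      case False
      then have "HT (f i \<star> m i) < HT g" using * by (simp add: HT_less_def)
      with lower[of "f i" "m i"] fm i False have
        "f i \<star> m i \<in> poly_vs.span {r \<in> reductive_multiples (\<star>) ge F. HT r \<le> HT (f i \<star> m i)}"
        by blast
      then show ?thesis
        by (rule subsetD[OF poly_vs.span_mono, rotated]) (use \<open>HT (f i \<star> m i) < HT g\<close> in auto)
    qed
  qed
  then show ?thesis by (subst g) (rule poly_vs.span_sum)
qed

text \<open>Modulo the span of generators below \<open>t\<close>, all generators with head term
  \<open>t\<close> lie on one line, so one representative \<open>r\<close> suffices. The assumption
  on s-polynomials concerns this \<open>t\<close> only, and only asks for membership in that
  span.\<close>

lemma span_decompose:
  assumes spol: "\<And>p q u1 u2. p \<in> F \<Longrightarrow> q \<in> F \<Longrightarrow> (t, u1, u2) \<in> critical_tuples (\<star>) ge p q \<Longrightarrow>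
      spol_r (\<star>) p q t u1 u2 \<in> poly_vs.span {r \<in> reductive_multiples (\<star>) ge F. HT r < t}"
    and v: "v \<in> poly_vs.span {r \<in> reductive_multiples (\<star>) ge F. HT r \<le> t}"
  obtains "v \<in> poly_vs.span {r \<in> reductive_multiples (\<star>) ge F. HT r < t}"
    | r c where "r \<in> reductive_multiples (\<star>) ge F" "HT r = t"
        "v - scale c r \<in> poly_vs.span {r \<in> reductive_multiples (\<star>) ge F. HT r < t}"
proof -
  let ?R = "reductive_multiples (\<star>) ge F"
  let ?S = "poly_vs.span {r \<in> ?R. HT r < t}"
  have proportional: "\<exists>d. r' - scale d r \<in> ?S"
    if r: "r \<in> ?R" "HT r = t" and r': "r' \<in> ?R" "HT r' = t" for r r'
  proof -
    obtain p m where p: "r = p \<star> m" "p \<in> F" "m \<in> monomials" "HT_reductive (\<star>) ge p m t"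
      using r unfolding reductive_multiples_def by auto
    obtain q m' where q: "r' = q \<star> m'" "q \<in> F" "m' \<in> monomials" "HT_reductive (\<star>) ge q m' t"
      using r' unfolding reductive_multiples_def by auto
    obtain a u where a: "a \<noteq> 0" "m = scale a (mon_of_term u)"
      using p(3) by (rule monomial_scale_term)
    obtain b u' where b: "b \<noteq> 0" "m' = scale b (mon_of_term u')"
      using q(3) by (rule monomial_scale_term)
    let ?p = "p \<star> mon_of_term u" and ?q = "q \<star> mon_of_term u'"
    have crit: "(t, u, u') \<in> critical_tuples (\<star>) ge p q"
      using p(4) q(4) a b by (simp add: critical_tuples_def HT_reductive_scale)
    then have "?q \<noteq> 0"
      by (auto simp: critical_tuples_def HT_reductive_def HT_eq_def)
    then have "HC ?q \<noteq> 0" by (rule HC_nonzero)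
    \<comment> \<open>With \<open>r = scale a ?p\<close> and \<open>r' = scale b ?q\<close>, the
      factor \<open>- (b * HC ?q)\<close> turns the \<open>?q\<close> part of the s-polynomial into
      \<open>r'\<close>; its \<open>?p\<close> part then is the stated multiple of
      \<open>r\<close>.\<close>
    then have "r' - scale (b * HC ?q * inverse (HC ?p) / a) r
        = scale (- (b * HC ?q)) (spol_r (\<star>) p q t u u')"
      using a b p(1) q(1)
      by (intro poly_mapping_eqI) (simp add: spol_r_def star_scale lookup_minus field_simps)
    then show ?thesis
      using spol[OF p(2) q(2) crit] poly_vs.span_scale by metis
  qed
  have "v \<in> ?S \<or> (\<exists>r\<in>?R. \<exists>c. HT r = t \<and> v - scale c r \<in> ?S)"
    using v
  proof (induction rule: poly_vs.span_induct_alt)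
    case base
    show ?case by (simp add: poly_vs.span_zero)
  next
    case (step c x y)
    show ?case
    proof (cases "HT x = t")
      case False
      then have "scale c x \<in> ?S"
        using step.hyps by (intro poly_vs.span_scale poly_vs.span_base) auto
      then have *: "scale c x + z \<in> ?S" if "z \<in> ?S" for z
        using that by (rule poly_vs.span_add)
      from step.IH show ?thesis
      proof (elim disjE bexE exE conjE)
        assume "y \<in> ?S"
        then show ?thesis using * by blast
      next
        fix r d assume r: "r \<in> ?R" "HT r = t" "y - scale d r \<in> ?S"
        from *[OF r(3)] have "scale c x + y - scale d r \<in> ?S"
          by (simp only: add_diff_eq)
        with r show ?thesis by blast
      qed
    next
      case True
      have x: "x \<in> ?R" using step.hyps by simp
      from step.IH show ?thesis
      proof (elim disjE bexE exE conjE)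
        assume "y \<in> ?S"
        \<comment> \<open>No representative has occurred so far, so \<open>x\<close> becomes
          it.\<close>
        then have "scale c x + y - scale c x \<in> ?S" by simp
        with x True show ?thesis by blast
      next
        fix r d assume r: "r \<in> ?R" "HT r = t" "y - scale d r \<in> ?S"
        obtain e where "x - scale e r \<in> ?S"
          using proportional[OF r(1,2) x True] by blast
        \<comment> \<open>Replacing \<open>x\<close> by \<open>scale e r\<close> modulo lower terms
          merges both contributions into the coefficient \<open>c * e + d\<close>.\<close>
        then have "scale c (x - scale e r) + (y - scale d r) \<in> ?S"
          using r(3) by (intro poly_vs.span_add poly_vs.span_scale)
        also have "scale c (x - scale e r) + (y - scale d r) = scale c x + y - scale (c * e + d) r"
          by (intro poly_mapping_eqI) (simp add: lookup_add lookup_minus algebra_simps)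
        finally show ?thesis using r by blast
      qed
    qed
  qed
  then show thesis using that by blast
qed

text \<open>A linear combination involves finitely many generators, one of which has the largest
  head term. The case 0 is separate because \<open>A\<close> may be empty.\<close>

lemma span_HT_bounded:
  assumes "v \<in> poly_vs.span A"
  obtains "v = 0" | a where "a \<in> A" and "v \<in> poly_vs.span {r \<in> A. HT r \<le> HT a}"
proof -
  have "v = 0 \<or> (\<exists>a\<in>A. v \<in> poly_vs.span {r \<in> A. HT r \<le> HT a})"
    using assms
  proof (induction rule: poly_vs.span_induct_alt)
    case base
    show ?case by simp
  next
    case (step c x y)
    let ?S = "\<lambda>t. poly_vs.span {r \<in> A. HT r \<le> t}"
    have x: "scale c x \<in> ?S t" if "HT x \<le> t" for t
      using step.hyps that by (intro poly_vs.span_scale poly_vs.span_base) auto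
    from step.IH show ?case
    proof (elim disjE bexE)
      assume "y = 0"
      with x[of "HT x"] step.hyps show ?thesis by auto
    next
      fix a assume a: "a \<in> A" "y \<in> ?S (HT a)"
      define b where "b = (if HT x \<le> HT a then a else x)"
      have b: "b \<in> A" "HT x \<le> HT b" "HT a \<le> HT b"
        using a step.hyps by (auto simp: b_def)
      have "y \<in> ?S (HT b)"
        by (rule subsetD[OF poly_vs.span_mono a(2)]) (use b in auto)
      with x[of "HT b"] b have "scale c x + y \<in> ?S (HT b)"
        by (intro poly_vs.span_add) auto
      with b show ?thesis by blast
    qed
  qed
  then show thesis using that by blast
qed

text \<open>Well-founded induction on the bound \<open>t\<close>: either the merged summand survives
  and gives the head term, or the bound drops.\<close>

lemma HT_span_reductive:
  assumes spol: "\<And>p q t u1 u2. p \<in> F \<Longrightarrow> q \<in> F \<Longrightarrow> (t, u1, u2) \<in> critical_tuples (\<star>) ge p q \<Longrightarrow>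
      spol_r (\<star>) p q t u1 u2 \<in> poly_vs.span {r \<in> reductive_multiples (\<star>) ge F. HT r < t}"
    and "v \<in> poly_vs.span {r \<in> reductive_multiples (\<star>) ge F. HT r \<le> t}" and "v \<noteq> 0"
  shows "HT v \<in> HT ` reductive_multiples (\<star>) ge F"
  using assms(2)
proof (induction t rule: less_induct)
  case (less t)
  let ?R = "reductive_multiples (\<star>) ge F"
  \<comment> \<open>A strict bound by \<open>t\<close> is traded for a weak bound by
    \<open>HT a < t\<close>, to which the induction hypothesis applies.\<close>
  have lower: ?thesis if "v \<in> poly_vs.span {r \<in> ?R. HT r < t}"
    using that
  proof (rule span_HT_bounded)
    fix a assume a: "a \<in> {r \<in> ?R. HT r < t}"
      and v: "v \<in> poly_vs.span {r \<in> {r \<in> ?R. HT r < t}. HT r \<le> HT a}"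
    have "v \<in> poly_vs.span {r \<in> ?R. HT r \<le> HT a}"
      by (rule subsetD[OF poly_vs.span_mono v]) auto
    with a less.IH show ?thesis by blast
  qed (use \<open>v \<noteq> 0\<close> in simp)
  from spol less.prems show ?case
  proof (rule span_decompose)
    assume "v \<in> poly_vs.span {r \<in> ?R. HT r < t}"
    then show ?thesis by (rule lower)
  next
    fix r c assume r: "r \<in> ?R" "HT r = t"
      and d: "v - scale c r \<in> poly_vs.span {r \<in> ?R. HT r < t}"
    show ?thesis
    proof (cases "c = 0")
      case True
      with d show ?thesis by (intro lower) simp
    next
      case False
      \<comment> \<open>The difference has no terms from \<open>t\<close> upwards, so
        \<open>v\<close> inherits the head term of \<open>scale c r\<close>.\<close>
      have "HT_less (v - scale c r) t"
        using d by (rule HT_less_span) (simp add: HT_less_def)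
      moreover have "HT_eq r t"
        using r zero_notin_reductive_multiples unfolding HT_eq_def by metis
      ultimately have "HT_eq v t"
        using False by (simp add: HT_eq_iff HT_less_iff lookup_minus)
      then show ?thesis using r unfolding HT_eq_def by force
    qed
  qed
qed

text \<open>Iterates condition (1): the assumption \<open>lower\<close> of
  \<open>standard_rep_in_span\<close> is exactly the induction hypothesis on
  \<open>HT (f \<star> m)\<close>.\<close>

lemma multiple_in_span:
  assumes rep: "\<And>f m. f \<in> F \<Longrightarrow> m \<in> monomials \<Longrightarrow>
      has_right_reductive_standard_rep (\<star>) ge F (f \<star> m)"
    and "f \<in> F" and "m \<in> monomials"
  shows "f \<star> m \<in> poly_vs.span {r \<in> reductive_multiples (\<star>) ge F. HT r \<le> HT (f \<star> m)}"
  using assms(2,3)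
proof (induction "HT (f \<star> m)" arbitrary: f m rule: less_induct)
  case less
  show ?case
    by (rule standard_rep_in_span[OF rep[OF less.prems]]) (rule less.hyps)
qed

lemma weak_groebner_if_standard_reps:
  assumes F: "0 \<notin> F"
    and rep: "\<And>f m. f \<in> F \<Longrightarrow> m \<in> monomials \<Longrightarrow>
      has_right_reductive_standard_rep (\<star>) ge F (f \<star> m)"
    and spol_rep: "\<And>p q t u1 u2. p \<in> F \<Longrightarrow> q \<in> F \<Longrightarrow> (t, u1, u2) \<in> critical_tuples (\<star>) ge p q \<Longrightarrow>
      has_right_reductive_standard_rep (\<star>) ge F (spol_r (\<star>) p q t u1 u2)"
  shows "weak_right_reductive_groebner_basis (\<star>) ge F"
proof -
  let ?R = "reductive_multiples (\<star>) ge F"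
  have spol: "spol_r (\<star>) p q t u1 u2 \<in> poly_vs.span {r \<in> ?R. HT r < t}"
    if pq: "p \<in> F" "q \<in> F" "(t, u1, u2) \<in> critical_tuples (\<star>) ge p q" for p q t u1 u2
  proof (cases "spol_r (\<star>) p q t u1 u2 = 0")
    case True
    then show ?thesis by (simp add: poly_vs.span_zero)
  next
    case False
    let ?s = "spol_r (\<star>) p q t u1 u2"
    \<comment> \<open>Cancellation at \<open>t\<close> makes the bound \<open>HT ?s\<close> from the
      standard representation strictly smaller than \<open>t\<close>.\<close>
    have "HT_less ?s t"
      unfolding spol_r_def using pq(3)
      by (intro HT_less_cancel) (auto simp: critical_tuples_def HT_reductive_def)
    with False have "HT ?s < t" by (simp add: HT_less_def)
    moreover have "?s \<in> poly_vs.span {r \<in> ?R. HT r \<le> HT ?s}"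
      by (rule standard_rep_in_span[OF spol_rep[OF pq]]) (rule multiple_in_span[OF rep])
    ultimately show ?thesis
      by (elim subsetD[OF poly_vs.span_mono, rotated]) auto
  qed
  have "HT g \<in> HT ` ?R" if g: "g \<in> ideal_r (\<star>) F" "g \<noteq> 0" for g
  proof -
    obtain n :: nat and f h where *: "g = (\<Sum>i=1..n. f i \<star> h i)" "\<forall>i\<in>{1..n}. f i \<in> F"
      using g(1) unfolding ideal_r_def by auto
    \<comment> \<open>Ideal elements have arbitrary right factors while (1) speaks of monomials;
      linearity bridges the gap.\<close>
    have "f i \<star> h i \<in> poly_vs.span ?R" if "i \<in> {1..n}" for i
    proof (rule star_in_span)
      fix m :: "'t \<Rightarrow>\<^sub>0 'k" assume "m \<in> monomials"
      with that *(2) have "f i \<star> m \<in> poly_vs.span {r \<in> ?R. HT r \<le> HT (f i \<star> m)}"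
        by (intro multiple_in_span rep) auto
      then show "f i \<star> m \<in> poly_vs.span ?R"
        by (rule subsetD[OF poly_vs.span_mono, rotated]) auto
    qed
    then have "g \<in> poly_vs.span ?R"
      unfolding *(1) by (rule poly_vs.span_sum)
    then show ?thesis
      by (rule span_HT_bounded) (use HT_span_reductive[OF spol] g(2) in blast)+
  qed
  \<comment> \<open>This yields the other inclusion between the two sets of head terms.\<close>
  moreover have "?R \<subseteq> ideal_r (\<star>) F - {0}"
    using zero_notin_reductive_multiples star_in_ideal
    by (auto simp: reductive_multiples_def HT_reductive_def HT_eq_def)
  ultimately show ?thesis
    unfolding weak_groebner_iff using F by blast
qed

end

section \<open>The characterization of weak Groebner bases\<close>

theorem theorem4p2p23:
  fixes star :: "('t::wellorder \<Rightarrow>\<^sub>0 'k::field) \<Rightarrow> ('t \<Rightarrow>\<^sub>0 'k) \<Rightarrow> ('t \<Rightarrow>\<^sub>0 'k)"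
    and ge :: "'t \<Rightarrow> 't \<Rightarrow> bool"
    and F :: "('t \<Rightarrow>\<^sub>0 'k) set"
  assumes "function_ring star"
    and "right_reductive_restriction star ge"
    and "F \<subseteq> UNIV - {0}"
  shows "weak_right_reductive_groebner_basis star ge F \<longleftrightarrow>
    (\<forall>f\<in>F. \<forall>m\<in>monomials. has_right_reductive_standard_rep star ge F (star f m)) \<and>
    (\<forall>p\<in>F. \<forall>q\<in>F. \<forall>(t, u1, u2)\<in>critical_tuples star ge p q.
       has_right_reductive_standard_rep star ge F (spol_r star p q t u1 u2))"
proof -
  interpret ordered_function_ring star
    using assms(1) by (rule ordered_function_ring.intro)
  show ?thesis
  \<comment> \<open>Forwards, both conditions are instances of one fact: every element of the ideal
    has a standard representation.\<close>
  proof (intro iffI conjI ballI; (elim conjE)?)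
    fix f m :: "'t \<Rightarrow>\<^sub>0 'k"
    assume "weak_right_reductive_groebner_basis star ge F" "f \<in> F"
    then show "has_right_reductive_standard_rep star ge F (star f m)"
      by (intro standard_rep_if_weak_groebner star_in_ideal)
  next
    fix p q :: "'t \<Rightarrow>\<^sub>0 'k" and z
    assume "weak_right_reductive_groebner_basis star ge F" "p \<in> F" "q \<in> F"
    then show "case z of (t, u1, u2) \<Rightarrow>
        has_right_reductive_standard_rep star ge F (spol_r star p q t u1 u2)"
      by (auto intro!: standard_rep_if_weak_groebner spol_in_ideal split: prod.split)
  next
    assume "\<forall>f\<in>F. \<forall>m\<in>monomials. has_right_reductive_standard_rep star ge F (star f m)"
      and "\<forall>p\<in>F. \<forall>q\<in>F. \<forall>(t, u1, u2)\<in>critical_tuples star ge p q.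
        has_right_reductive_standard_rep star ge F (spol_r star p q t u1 u2)"
    then show "weak_right_reductive_groebner_basis star ge F"
      using assms(3) by (intro weak_groebner_if_standard_reps) blast+
  qed
qed

end
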